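(* Consider a game among $N$ interdependent users with investments $\mathbf{x}\in\mathbb{R}_{\ge0}^N$ and cost functions $$g_i(\mathbf{x})=\exp\Big(-a x_1-\sum_{j=2}^N x_j\Big)+c\,x_i,\qquad i=1,\dots,N,$$ where $a,c$ are real numbers with $0<c<1<a$. In each of the following cases, under the stated parameter condition, exit equilibria of the stated form are possible (i.e. exist), and when the exit equilibria of all users are of that form, the stated conclusions hold. (Case $\alpha$) If $a<N-1$: the exit equilibrium $\hat{\mathbf{x}}^1$ for user $1$ has $\hat x^1_1=0$ and $\hat x^1_j>0$ for all $j\ne 1$, and for each $i\neq 1$ the exit equilibrium $\hat{\mathbf{x}}^i$ for user $i$ has $\hat x^i_1>0$ and $\hat x^i_j=0$ for all $j\ne1$; voluntary participation never holds in the Externality mechanism and weak budget balance never holds in the Pivotal mechanism. (Case $\beta$) If $a>N-1$: the exit equilibrium $\hat{\mathbf{x}}^1$ for user $1$ has $\hat x^1_1>0$ and $\hat x^1_j=0$ for all $j\ne 1$, and for each $i\neq 1$ the exit equilibrium $\hat{\mathbf{x}}^i$ for user $i$ has $\hat x^i_1>0$ and $\hat x^i_j=0$ for all $j\ne1$; voluntary participation never holds in the Externality mechanism and weak budget balance never holds in the Pivotal mechanism.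
   Context: Write $g_i(\mathbf{x})=f_i(\mathbf{x})+h_i(x_i)$ with risk $f_i(\mathbf{x})=\exp(-a x_1-\sum_{j=2}^N x_j)$ and investment cost $h_i(x_i)=c x_i$. The socially optimal profile $\mathbf{x}^*$ is the minimizer of $\sum_i g_i(\mathbf{x})$ over $\mathbf{x}\in\mathbb{R}_{\ge 0}^N$. An exit equilibrium for user $i$ is a profile $\hat{\mathbf{x}}^i\in\mathbb{R}_{\ge0}^N$ that is a Nash equilibrium between user $i$ and the coalition of the other users: $\hat x^i_i$ minimizes $x_i\mapsto g_i(\hat{\mathbf{x}}^i_{-i},x_i)$ over $x_i\ge 0$, and $\hat{\mathbf{x}}^i_{-i}$ minimizes $\mathbf{x}_{-i}\mapsto\sum_{j\ne i}g_j(\mathbf{x}_{-i},\hat x^i_i)$ over $\mathbf{x}_{-i}\in\mathbb{R}_{\ge0}^{N-1}$. Externality mechanism: it implements $\mathbf{x}^*$ with taxes $$t_i^E=-\sum_{j}x_j^*\frac{\partial f_i}{\partial x_j}(\mathbf{x}^* )-x_i^*\frac{\partial h_i}{\partial x_i}(x_i^* ).$$ The voluntary participation condition of user $i$ is $g_i(\mathbf{x}^* )+t_i^E\le g_i(\hat{\mathbf{x}}^i)$. "Voluntary participation holds" means that this condition is satisfied for all users $i$; it does not hold if at least one user's condition is violated. Pivotal mechanism: it implements $\mathbf{x}^*$ with taxes $t_i^P=\sum_{j\ne i}g_j(\mathbf{x}^* )-\sum_{j\neq i}g_j(\hat{\mathbf{x}}^i)$. Weak budget balance means $\sum_i t_i^P\ge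 0$; a budget deficit means $\sum_i t^P_i<0$.
   Formalization: N ≥ 2 is assumed (claims fail for N=1), and in case β the Externality claim is stated only for N ≥ 3 or 2a > e·c: for N=2 and 2a ≤ e·c (e.g. a=1.1, c=0.9) voluntary participation does hold. *)

theory Defs
  imports "HOL-Analysis.Analysis"
begin

text \<open>
  Users are \<open>1, \<dots>, N\<close>. A profile in \<open>\<real>\<^sub>\<ge>\<^sub>0\<^sup>N\<close> is an extensional function on \<open>{1..N}\<close>,
  so that two profiles are equal iff they agree on all users.
\<close>

definition profiles :: "nat \<Rightarrow> (nat \<Rightarrow> real) set" where
  "profiles N = {1..N} \<rightarrow>\<^sub>E {0..}"

definition cost :: "(nat \<Rightarrow> (nat \<Rightarrow> real) \<Rightarrow> real) \<Rightarrow> (nat \<Rightarrow> real \<Rightarrow> real)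
    \<Rightarrow> nat \<Rightarrow> (nat \<Rightarrow> real) \<Rightarrow> real" where
  "cost f h i x = f i x + h i (x i)"

definition social_optimum :: "nat \<Rightarrow> (nat \<Rightarrow> (nat \<Rightarrow> real) \<Rightarrow> real) \<Rightarrow> (nat \<Rightarrow> real)" where
  "social_optimum N g = (THE x. is_arg_min (\<lambda>y. \<Sum>i=1..N. g i y) (\<lambda>y. y \<in> profiles N) x)"

text \<open>
  In the last conjunct the coalition's choice of \<open>x\<^sub>-\<^sub>i\<close> is encoded by letting it range over all
  profiles whose \<open>i\<close>-th component is the one chosen by user \<open>i\<close>.
\<close>

definition exit_equilibrium ::
    "nat \<Rightarrow> (nat \<Rightarrow> (nat \<Rightarrow> real) \<Rightarrow> real) \<Rightarrow> nat \<Rightarrow> (nat \<Rightarrow> real) \<Rightarrow> bool" where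
  "exit_equilibrium N g i x \<longleftrightarrow>
     x \<in> profiles N \<and>
     is_arg_min (\<lambda>y. g i (x(i := y))) (\<lambda>y. 0 \<le> y) (x i) \<and>
     is_arg_min (\<lambda>z. \<Sum>j\<in>{1..N} - {i}. g j z) (\<lambda>z. z \<in> profiles N \<and> z i = x i) x"

definition partial_deriv :: "((nat \<Rightarrow> real) \<Rightarrow> real) \<Rightarrow> nat \<Rightarrow> (nat \<Rightarrow> real) \<Rightarrow> real" where
  "partial_deriv F j x = deriv (\<lambda>y. F (x(j := y))) (x j)"

definition externality_tax :: "nat \<Rightarrow> (nat \<Rightarrow> (nat \<Rightarrow> real) \<Rightarrow> real) \<Rightarrow> (nat \<Rightarrow> real \<Rightarrow> real)
    \<Rightarrow> nat \<Rightarrow> real" where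
  "externality_tax N f h i =
     (let xs = social_optimum N (cost f h)
      in - (\<Sum>j=1..N. xs j * partial_deriv (f i) j xs) - xs i * deriv (h i) (xs i))"

text \<open>Below, \<open>xh i\<close> is the exit equilibrium of user \<open>i\<close> and \<open>xh i j\<close> its \<open>j\<close>-th component.\<close>

definition voluntary_participation :: "nat \<Rightarrow> (nat \<Rightarrow> (nat \<Rightarrow> real) \<Rightarrow> real) \<Rightarrow> (nat \<Rightarrow> real)
    \<Rightarrow> (nat \<Rightarrow> nat \<Rightarrow> real) \<Rightarrow> bool" where
  "voluntary_participation N g t xh \<longleftrightarrow>
     (\<forall>i\<in>{1..N}. g i (social_optimum N g) + t i \<le> g i (xh i))"

definition pivotal_tax :: "nat \<Rightarrow> (nat \<Rightarrow> (nat \<Rightarrow> real) \<Rightarrow> real) \<Rightarrow> (nat \<Rightarrow> nat \<Rightarrow> real)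
    \<Rightarrow> nat \<Rightarrow> real" where
  "pivotal_tax N g xh i =
     (\<Sum>j\<in>{1..N} - {i}. g j (social_optimum N g)) - (\<Sum>j\<in>{1..N} - {i}. g j (xh i))"

definition weak_budget_balance :: "nat \<Rightarrow> (nat \<Rightarrow> real) \<Rightarrow> bool" where
  "weak_budget_balance N t \<longleftrightarrow> 0 \<le> (\<Sum>i=1..N. t i)"

definition risk :: "nat \<Rightarrow> real \<Rightarrow> nat \<Rightarrow> (nat \<Rightarrow> real) \<Rightarrow> real" where
  "risk N a i x = exp (- a * x 1 - (\<Sum>j=2..N. x j))"

definition investment_cost :: "real \<Rightarrow> nat \<Rightarrow> real \<Rightarrow> real" where
  "investment_cost c i y = c * y"

abbreviation user_cost :: "nat \<Rightarrow> real \<Rightarrow> real \<Rightarrow> nat \<Rightarrow> (nat \<Rightarrow> real) \<Rightarrow> real" where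
  "user_cost N a c \<equiv> cost (risk N a) (investment_cost c)"

definition exit_equilibria :: "nat \<Rightarrow> real \<Rightarrow> real \<Rightarrow> (nat \<Rightarrow> nat \<Rightarrow> real) \<Rightarrow> bool" where
  "exit_equilibria N a c xh \<longleftrightarrow> (\<forall>i\<in>{1..N}. exit_equilibrium N (user_cost N a c) i (xh i))"

definition form_alpha :: "nat \<Rightarrow> (nat \<Rightarrow> nat \<Rightarrow> real) \<Rightarrow> bool" where
  "form_alpha N xh \<longleftrightarrow>
     (xh 1 1 = 0 \<and> (\<forall>j\<in>{1..N}. j \<noteq> 1 \<longrightarrow> xh 1 j > 0)) \<and>
     (\<forall>i\<in>{1..N}. i \<noteq> 1 \<longrightarrow> xh i 1 > 0 \<and> (\<forall>j\<in>{1..N}. j \<noteq> 1 \<longrightarrow> xh i j = 0))"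

definition form_beta :: "nat \<Rightarrow> (nat \<Rightarrow> nat \<Rightarrow> real) \<Rightarrow> bool" where
  "form_beta N xh \<longleftrightarrow>
     (xh 1 1 > 0 \<and> (\<forall>j\<in>{1..N}. j \<noteq> 1 \<longrightarrow> xh 1 j = 0)) \<and>
     (\<forall>i\<in>{1..N}. i \<noteq> 1 \<longrightarrow> xh i 1 > 0 \<and> (\<forall>j\<in>{1..N}. j \<noteq> 1 \<longrightarrow> xh i j = 0))"

end

theory Submission
  imports Defs
begin

text \<open>
  With effective effort \<open>s = a x\<^sub>1 + \<Sum>\<^sub>j\<^sub>\<ge>\<^sub>2 x\<^sub>j\<close> every objective has the form \<open>K e\<^sup>-\<^sup>s + m s\<close> up to a
  constant: \<open>m = c / a\<close> when user 1 invests, because \<open>a > 1\<close> makes user 1 the cheapest source of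
  effort, and \<open>m = c\<close> otherwise. Its minimiser is \<open>s = ln (K / m)\<close>, where the risk is \<open>m / K\<close>; here
  \<open>K\<close> is the number of users who share the objective. With \<open>L = ln (N / (N - 1))\<close>, the taxes of the
  Pivotal mechanism sum to \<open>(c / a) (N - 1) L - c - c ln ((N - 1) / c)\<close> in case \<open>\<alpha>\<close> and to
  \<open>(c / a) (N - 1) (L - 1)\<close> in case \<open>\<beta>\<close>, both negative since \<open>(N - 1) L < 1\<close>. In the Externality
  mechanism user 2 compares \<open>(c / (N a)) (1 + ln (N a / c))\<close> with \<open>c / ((N - 1) a)\<close>.
\<close>

section \<open>The one-variable problem of minimising \<open>K * exp (- s) + m * s\<close>\<close>

text \<open>In terms of \<open>u = K / m * exp (- s)\<close> both parts reduce to
  \<open>ln u \<le> u - 1\<close>, where equality holds only for \<open>u = 1\<close>. The first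
  part proves optimality, the second pins down the effort of a given optimum.\<close>

lemma exp_minus_plus_linear_ge:
  fixes K m s :: real
  assumes "0 < K" "0 < m"
  shows "m + m * ln (K / m) \<le> K * exp (- s) + m * s"
    and "K * exp (- s) + m * s \<le> m + m * ln (K / m) \<Longrightarrow> s = ln (K / m)"
proof -
  define u where "u = K / m * exp (- s)"
  have u: "0 < u" and lnu: "ln u = ln (K / m) - s"
    using assms ln_mult_pos[of "K / m" "exp (- s)"] by (simp_all add: u_def)
  have mu: "K * exp (- s) = m * u" using assms by (simp add: u_def)
  have "m * ln u \<le> m * (u - 1)"
    using ln_le_minus_one[OF u] assms by simp
  then show "m + m * ln (K / m) \<le> K * exp (- s) + m * s"
    unfolding mu lnu by (simp add: algebra_simps)
  assume "K * exp (- s) + m * s \<le> m + m * ln (K / m)"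
  then have "m * (u - 1) \<le> m * ln u"
    unfolding mu lnu by (simp add: algebra_simps)
  then have "u - 1 \<le> ln u" using assms by simp
  then have "u = 1" using ln_le_minus_one[OF u] ln_eq_minus_one[OF u] by simp
  then show "s = ln (K / m)" using lnu by simp
qed

lemma exp_minus_plus_linear_at_min:
  fixes K m :: real
  assumes "0 < K" "0 < m"
  shows "K * exp (- ln (K / m)) + m * ln (K / m) = m + m * ln (K / m)"
  using assms by (simp add: exp_minus field_simps)

text \<open>Since \<open>exp (- y) \<ge> 1 - y\<close>, extra effort does not pay once its marginal
  benefit \<open>K * exp (- s)\<close> is at most its unit price \<open>m\<close>. This justifies
  the zero components of the equilibria.\<close>

lemma exp_minus_plus_linear_mono:
  fixes K m s y :: real
  assumes "0 \<le> K" "K * exp (- s) \<le> m" "0 \<le> y"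
  shows "K * exp (- s) \<le> K * exp (- (s + y)) + m * y"
proof -
  have "K * exp (- s) * (1 - y) \<le> K * exp (- s) * exp (- y)"
    using exp_ge_add_one_self[of "- y"] assms(1) by (intro mult_left_mono) auto
  moreover have "K * exp (- s) * y \<le> m * y"
    using assms by (intro mult_right_mono) auto
  moreover have "exp (- (s + y)) = exp (- s) * exp (- y)"
    by (simp add: exp_diff exp_minus divide_inverse)
  ultimately show ?thesis by (simp only:) (simp add: algebra_simps)
qed

section \<open>Effective effort and its cost\<close>

definition effort :: "nat \<Rightarrow> real \<Rightarrow> (nat \<Rightarrow> real) \<Rightarrow> real" where
  "effort N a x = a * x 1 + (\<Sum>j=2..N. x j)"

text \<open>Restricted to \<open>{1..N}\<close> because profiles are extensional.\<close>

definition single_investor :: "nat \<Rightarrow> nat \<Rightarrow> real \<Rightarrow> nat \<Rightarrow> real" where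
  "single_investor N k y = (\<lambda>j\<in>{1..N}. if j = k then y else 0)"

lemma risk_eq: "risk N a i x = exp (- effort N a x)"
  by (simp add: risk_def effort_def algebra_simps)

lemma user_cost_eq: "user_cost N a c i x = exp (- effort N a x) + c * x i"
  by (simp add: cost_def risk_eq investment_cost_def)

lemma sum_user_cost:
  "(\<Sum>j\<in>A. user_cost N a c j x) = real (card A) * exp (- effort N a x) + c * (\<Sum>j\<in>A. x j)"
  by (simp add: user_cost_eq sum.distrib sum_distrib_left)

lemma sum_coalition_cost:
  assumes "i \<in> {1..N}"
  shows "(\<Sum>j\<in>{1..N} - {i}. user_cost N a c j x) =
    (real N - 1) * exp (- effort N a x) + c * (\<Sum>j\<in>{1..N} - {i}. x j)"
  using assms by (simp add: sum_user_cost of_nat_diff)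

lemma users_minus_first: "{1..N :: nat} - {1} = {2..N}"
  by auto

lemma single_investor_mem_profiles: "0 \<le> y \<Longrightarrow> single_investor N k y \<in> profiles N"
  by (auto simp: single_investor_def profiles_def)

lemma single_investor_apply:
  "j \<in> {1..N} \<Longrightarrow> single_investor N k y j = (if j = k then y else 0)"
  by (simp add: single_investor_def)

lemma sum_single_investor:
  assumes "A \<subseteq> {1..N}"
  shows "(\<Sum>j\<in>A. single_investor N k y j) = (if k \<in> A then y else 0)"
proof -
  have "(\<Sum>j\<in>A. single_investor N k y j) = (\<Sum>j\<in>A. if j = k then y else 0)"
    using assms by (intro sum.cong) (auto simp: single_investor_def)
  also have "\<dots> = (if k \<in> A then y else 0)"
    using finite_subset[OF assms] by (simp add: sum.delta)
  finally show ?thesis .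
qed

lemma effort_single_investor:
  assumes "1 \<le> N" "k \<in> {1..N}"
  shows "effort N a (single_investor N k y) = (if k = 1 then a * y else y)"
  using assms by (auto simp: effort_def sum_single_investor single_investor_apply)

lemma profiles_nonneg: "x \<in> profiles N \<Longrightarrow> j \<in> {1..N} \<Longrightarrow> 0 \<le> x j"
  by (auto simp: profiles_def)

lemma sum_users_split:
  fixes x :: "nat \<Rightarrow> real"
  assumes "1 \<le> N"
  shows "(\<Sum>j=1..N. x j) = x 1 + (\<Sum>j=2..N. x j)"
  using assms by (simp add: sum.atLeast_Suc_atMost numeral_2_eq_2)

text \<open>The gap between the two sides is \<open>(a - 1)\<close> times the investment of users 2
  to \<open>N\<close>. Hence a unit of effort costs at least \<open>c / a\<close>, with equality
  only if user 1 alone invests.\<close>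

lemma effort_le_total:
  assumes "1 \<le> N" "1 < a" "x \<in> profiles N"
  shows "effort N a x \<le> a * (\<Sum>j=1..N. x j)"
    and "a * (\<Sum>j=1..N. x j) \<le> effort N a x \<Longrightarrow> j \<in> {2..N} \<Longrightarrow> x j = 0"
proof -
  have nn: "0 \<le> x j" if "j \<in> {2..N}" for j
    using that profiles_nonneg[OF assms(3)] by auto
  then have S: "0 \<le> (\<Sum>j=2..N. x j)" by (intro sum_nonneg)
  have eq: "a * (\<Sum>j=1..N. x j) = effort N a x + (a - 1) * (\<Sum>j=2..N. x j)"
    unfolding sum_users_split[OF assms(1)] by (simp add: effort_def algebra_simps)
  show "effort N a x \<le> a * (\<Sum>j=1..N. x j)"
    unfolding eq using S assms(2) by simp
  assume "a * (\<Sum>j=1..N. x j) \<le> effort N a x" and j: "j \<in> {2..N}"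
  then have "(a - 1) * (\<Sum>j=2..N. x j) \<le> 0" unfolding eq by simp
  then have "(\<Sum>j=2..N. x j) = 0"
    using S assms(2) by (simp add: mult_le_0_iff)
  then show "x j = 0"
    using j nn by (subst (asm) sum_nonneg_eq_0_iff) auto
qed

lemma sum_only_first:
  fixes x :: "nat \<Rightarrow> real"
  assumes "A \<subseteq> {1..N}" "\<And>j. j \<in> {1..N} \<Longrightarrow> j \<noteq> 1 \<Longrightarrow> x j = 0"
  shows "(\<Sum>j\<in>A. x j) = (if 1 \<in> A then x 1 else 0)"
proof -
  have "(\<Sum>j\<in>A. x j) = (\<Sum>j\<in>A. if j = 1 then x 1 else 0)"
    using assms by (intro sum.cong) auto
  also have "\<dots> = (if 1 \<in> A then x 1 else 0)"
    using finite_subset[OF assms(1)] by (simp add: sum.delta)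
  finally show ?thesis .
qed

section \<open>The social optimum\<close>

text \<open>The total cost is bounded below by the one-variable problem with \<open>K = N\<close>
  and \<open>m = c / a\<close>. The description by \<open>THE\<close> also calls for uniqueness,
  which comes from the equality cases of both bounds: one fixes the effort, the other who provides
  it.\<close>

lemma social_optimum_eq:
  assumes "2 \<le> N" "0 < c" "c < 1" "1 < a"
  shows "social_optimum N (user_cost N a c) = single_investor N 1 (ln (real N * a / c) / a)"
    (is "_ = ?x")
  unfolding social_optimum_def
proof (rule the_equality)
  define m where "m = c / a"
  have m: "0 < m" and N: "0 < real N" using assms by (simp_all add: m_def)
  have Km: "real N * a / c = real N / m" by (simp add: m_def)
  have "c < 1 * a" using assms by simp
  also have "1 * a \<le> real N * a" using assms by (intro mult_right_mono) auto
  finally have "1 < real N / m" using assms by (simp add: m_def less_divide_eq)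
  then have pos: "0 \<le> ln (real N * a / c) / a" using assms by (simp add: Km)
  have prof: "?x \<in> profiles N" by (rule single_investor_mem_profiles[OF pos])
  have obj: "(\<Sum>i=1..N. user_cost N a c i z) = real N * exp (- effort N a z) + m * (a * (\<Sum>j=1..N. z j))" for z
    using assms by (simp add: sum_user_cost m_def)
  have objx: "(\<Sum>i=1..N. user_cost N a c i ?x) = m + m * ln (real N / m)"
    using exp_minus_plus_linear_at_min[OF N m] assms
    unfolding obj by (simp add: effort_single_investor sum_single_investor Km)
  have lb: "real N * exp (- effort N a z) + m * effort N a z \<le> (\<Sum>i=1..N. user_cost N a c i z)"
    if "z \<in> profiles N" for z
    unfolding obj using effort_le_total(1)[of N a z] that assms m by simp
  show "is_arg_min (\<lambda>y. \<Sum>i=1..N. user_cost N a c i y) (\<lambda>y. y \<in> profiles N) ?x"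
    unfolding is_arg_min_linorder objx
    using prof lb exp_minus_plus_linear_ge(1)[OF N m] by (auto intro: order_trans)
  fix z assume "is_arg_min (\<lambda>y. \<Sum>i=1..N. user_cost N a c i y) (\<lambda>y. y \<in> profiles N) z"
  then have z: "z \<in> profiles N"
    and le: "(\<Sum>i=1..N. user_cost N a c i z) \<le> m + m * ln (real N / m)"
    unfolding is_arg_min_linorder objx[symmetric] using prof by auto
  have s: "effort N a z = ln (real N / m)"
    using exp_minus_plus_linear_ge(2)[OF N m] lb[OF z] le by force
  \<comment> \<open>As the effort is already the optimal one, any excess of the investment cost over
    \<open>m * effort N a z\<close> would push \<open>z\<close> above the minimum.\<close>
  have "m * (a * (\<Sum>j=1..N. z j)) \<le> m * effort N a z"
    using le exp_minus_plus_linear_at_min[OF N m] unfolding obj s by simp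
  then have z0: "z j = 0" if "j \<in> {2..N}" for j
    using effort_le_total(2)[of N a z j] z assms m that by simp
  then have "z 1 = ln (real N * a / c) / a"
    using s assms unfolding effort_def Km by (simp add: field_simps)
  then have "z j = ?x j" if "j \<in> {1..N}" for j
    using z0 that by (cases "j = 1") (auto simp: single_investor_apply)
  with z prof show "z = ?x" unfolding profiles_def by (rule PiE_ext)
qed

section \<open>Exit equilibria: existence and the effort they force\<close>

lemma exit_equilibrium_iff:
  assumes "i \<in> {1..N}"
  shows "exit_equilibrium N (user_cost N a c) i x \<longleftrightarrow>
     x \<in> profiles N \<and>
     (\<forall>y\<ge>0. exp (- effort N a x) + c * x i \<le> exp (- effort N a (x(i := y))) + c * y) \<and>
     (\<forall>z\<in>profiles N. z i = x i \<longrightarrow>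
        (real N - 1) * exp (- effort N a x) + c * (\<Sum>j\<in>{1..N} - {i}. x j)
        \<le> (real N - 1) * exp (- effort N a z) + c * (\<Sum>j\<in>{1..N} - {i}. z j))"
  unfolding exit_equilibrium_def is_arg_min_linorder sum_coalition_cost[OF assms]
  using profiles_nonneg[of x N i] assms by (auto simp: user_cost_eq)

lemma effort_upd_first: "effort N a (x(1 := y)) = a * y + (\<Sum>j=2..N. x j)"
  by (simp add: effort_def)

lemma effort_upd_other:
  assumes "i \<in> {2..N}"
  shows "effort N a (x(i := y)) = effort N a x + (y - x i)"
proof -
  have "(\<Sum>j=2..N. (x(i := y)) j) = y + (\<Sum>j\<in>{2..N} - {i}. x j)"
    using assms by (simp add: sum.remove[of _ i])
  moreover have "(\<Sum>j=2..N. x j) = x i + (\<Sum>j\<in>{2..N} - {i}. x j)"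
    using assms by (simp add: sum.remove[of _ i])
  ultimately show ?thesis using assms by (auto simp: effort_def)
qed

text \<open>The coalition contains user 1, so it buys effort at price \<open>c / a\<close> and
  solves the problem with \<open>K = N - 1\<close>. The remaining risk
  \<open>c / ((N - 1) * a)\<close> is below the price \<open>c\<close> of user \<open>i\<close>, who
  therefore stays at 0.\<close>

lemma exit_equilibrium_other:
  assumes "2 \<le> N" "0 < c" "c < 1" "1 < a" and i: "i \<in> {2..N}"
  shows "exit_equilibrium N (user_cost N a c) i
           (single_investor N 1 (ln ((real N - 1) * a / c) / a))" (is "exit_equilibrium _ _ _ ?x")
    and "0 < ln ((real N - 1) * a / c)"
proof -
  define m where "m = c / a"
  have m: "0 < m" and N: "0 < real N - 1" using assms by (simp_all add: m_def)
  have Km: "(real N - 1) * a / c = (real N - 1) / m" by (simp add: m_def)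
  have "c < 1 * a" using assms by simp
  also have "1 * a \<le> (real N - 1) * a" using assms by (intro mult_right_mono) auto
  finally have "1 < (real N - 1) * a / c" using assms by (simp add: less_divide_eq)
  then show pos: "0 < ln ((real N - 1) * a / c)" by simp
  have eff: "effort N a ?x = ln ((real N - 1) / m)"
    using assms by (simp add: effort_single_investor Km)
  have risk: "1 * exp (- effort N a ?x) = m / (real N - 1)"
    unfolding eff using m N by (simp add: exp_minus)
  have "m / (real N - 1) \<le> c / 1"
    unfolding m_def using assms by (intro frac_le) (auto simp: divide_le_eq)
  then have "exp (- effort N a ?x) \<le> exp (- (effort N a ?x + y)) + c * y" if "0 \<le> y" for y
    using exp_minus_plus_linear_mono[of 1 "effort N a ?x" c y] that risk by simp
  moreover have "(real N - 1) * exp (- effort N a ?x) + c * (\<Sum>j\<in>{1..N} - {i}. ?x j)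
        \<le> (real N - 1) * exp (- effort N a z) + c * (\<Sum>j\<in>{1..N} - {i}. z j)"
    if z: "z \<in> profiles N" "z i = 0" for z
  proof -
    have "(real N - 1) * exp (- effort N a ?x) + c * (\<Sum>j\<in>{1..N} - {i}. ?x j)
        = m + m * ln ((real N - 1) / m)"
      using i assms exp_minus_plus_linear_at_min[OF N m]
      unfolding eff sum_single_investor[OF Diff_subset] by (simp add: Km) (simp add: m_def)
    also have "\<dots> \<le> (real N - 1) * exp (- effort N a z) + m * effort N a z"
      by (rule exp_minus_plus_linear_ge(1)[OF N m])
    also have "m * effort N a z \<le> m * (a * (\<Sum>j=1..N. z j))"
      using effort_le_total(1)[of N a z] z assms m by simp
    also have "\<dots> = c * (\<Sum>j\<in>{1..N} - {i}. z j)"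
      using i z assms sum.remove[of "{1..N}" i z] by (simp add: m_def)
    finally show ?thesis by simp
  qed
  ultimately show "exit_equilibrium N (user_cost N a c) i ?x"
    using i pos assms
    by (subst exit_equilibrium_iff)
      (auto simp: single_investor_mem_profiles effort_upd_other single_investor_apply)
qed

text \<open>The coalition may deviate to user 1 alone providing the optimal effort. Being no worse
  than that, \<open>x\<close> attains the minimum of the one-variable problem, whose minimiser is
  unique.\<close>

lemma effort_exit_equilibrium_other:
  assumes "2 \<le> N" "0 < c" "c < 1" "1 < a" and i: "i \<in> {2..N}"
    and x: "exit_equilibrium N (user_cost N a c) i x"
    and x0: "\<And>j. j \<in> {1..N} \<Longrightarrow> j \<noteq> 1 \<Longrightarrow> x j = 0"
  shows "effort N a x = ln ((real N - 1) * a / c)"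
proof -
  define m where "m = c / a"
  have m: "0 < m" and N: "0 < real N - 1" using assms by (simp_all add: m_def)
  have Km: "(real N - 1) * a / c = (real N - 1) / m" by (simp add: m_def)
  let ?z = "single_investor N 1 (ln ((real N - 1) / m) / a)"
  have z: "?z \<in> profiles N"
    using exit_equilibrium_other(2)[OF assms(1-5)] assms
    by (intro single_investor_mem_profiles) (simp add: Km)
  have eff: "effort N a x = a * x 1"
    using x0 by (auto simp: effort_def)
  have "(real N - 1) * exp (- effort N a x) + c * (\<Sum>j\<in>{1..N} - {i}. x j)
        \<le> (real N - 1) * exp (- effort N a ?z) + c * (\<Sum>j\<in>{1..N} - {i}. ?z j)"
    using x z i x0[of i] by (subst (asm) exit_equilibrium_iff) (auto simp: single_investor_apply)
  moreover have "(\<Sum>j\<in>{1..N} - {i}. x j) = x 1"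
    using i assms by (subst sum_only_first[of _ N]) (auto intro!: x0)
  ultimately have "(real N - 1) * exp (- effort N a x) + m * effort N a x
      \<le> m + m * ln ((real N - 1) / m)"
    using exp_minus_plus_linear_at_min[OF N m] i assms
    by (simp add: sum_single_investor effort_single_investor m_def eff)
  from exp_minus_plus_linear_ge(2)[OF N m this] show ?thesis by (simp add: Km)
qed

text \<open>Without user 1 the coalition pays \<open>c\<close> per unit of effort and wants the
  total \<open>y\<close>. Every split of \<open>y\<close> among its members costs the same; the even
  one makes all of them positive.\<close>

lemma exit_equilibrium_first_alpha:
  assumes "0 < c" "c < 1" "1 < a" and lt: "a < real N - 1"
  defines "y \<equiv> ln ((real N - 1) / c)"
  defines "x \<equiv> (\<lambda>j\<in>{1..N}. if j = 1 then 0 else y / (real N - 1))"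
  shows "exit_equilibrium N (user_cost N a c) 1 x" and "0 < y"
proof -
  have N: "0 < real N - 1" "1 \<le> N" using assms by (auto simp: not_less_eq_eq)
  show y: "0 < y" using assms N by (simp add: y_def)
  have "(\<Sum>j=2..N. x j) = (\<Sum>j=2..N. y / (real N - 1))"
    by (intro sum.cong) (auto simp: x_def)
  also have "\<dots> = y" using N by (simp add: of_nat_diff)
  finally have S: "(\<Sum>j=2..N. x j) = y" .
  have x1: "x 1 = 0" using N by (simp add: x_def)
  have eff: "effort N a x = y" unfolding effort_def S x1 by simp
  have risk: "exp (- y) = c / (real N - 1)"
    using assms N by (simp add: y_def exp_minus)
  have prof: "x \<in> profiles N" using y N by (auto simp: x_def profiles_def)
  have "exp (- y) \<le> exp (- (a * t + y)) + c * t" if "0 \<le> t" for t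
  proof -
    \<comment> \<open>Investing \<open>t\<close> gives user 1 the effort \<open>a * t\<close> at
      unit price \<open>c / a\<close>; \<open>a < N - 1\<close> puts the risk
      \<open>c / (N - 1)\<close> below that price.\<close>
    have "c / (real N - 1) \<le> c / a" using assms by (intro divide_left_mono) auto
    then show ?thesis
      using exp_minus_plus_linear_mono[of 1 y "c / a" "a * t"] that risk assms by (simp add: add.commute)
  qed
  moreover have "(real N - 1) * exp (- y) + c * y
        \<le> (real N - 1) * exp (- (\<Sum>j=2..N. z j)) + c * (\<Sum>j=2..N. z j)" for z
    using exp_minus_plus_linear_ge(1)[OF N(1) assms(1)]
      exp_minus_plus_linear_at_min[OF N(1) assms(1)] unfolding y_def by simp
  ultimately show "exit_equilibrium N (user_cost N a c) 1 x"
    using prof N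
    by (subst exit_equilibrium_iff)
      (auto simp: users_minus_first[simplified] effort_upd_first[simplified] eff S x1[simplified] effort_def)
qed

lemma effort_exit_equilibrium_first_alpha:
  assumes "2 \<le> N" "0 < c" "c < 1"
    and x: "exit_equilibrium N (user_cost N a c) 1 x" and x1: "x 1 = 0"
  shows "effort N a x = ln ((real N - 1) / c)"
proof -
  have N: "0 < real N - 1" using assms by simp
  \<comment> \<open>The coalition's cost depends only on its total, so concentrating everything on
    user 2 is a sufficient deviation, although it lacks the form of case \<alpha>.\<close>
  let ?z = "single_investor N 2 (ln ((real N - 1) / c))"
  have "1 \<le> (real N - 1) / c" using assms by (simp add: le_divide_eq)
  then have z: "?z \<in> profiles N" by (intro single_investor_mem_profiles) simp
  have z1: "?z 1 = x 1" using assms by (simp add: single_investor_apply)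
  have "\<forall>z\<in>profiles N. z 1 = x 1 \<longrightarrow>
        (real N - 1) * exp (- effort N a x) + c * (\<Sum>j\<in>{1..N} - {1}. x j)
        \<le> (real N - 1) * exp (- effort N a z) + c * (\<Sum>j\<in>{1..N} - {1}. z j)"
    using x assms exit_equilibrium_iff[of 1 N a c x] by simp
  from this[rule_format, OF z z1] have "(real N - 1) * exp (- effort N a x) + c * effort N a x
      \<le> c + c * ln ((real N - 1) / c)"
    using exp_minus_plus_linear_at_min[OF N assms(2)] assms
    unfolding users_minus_first
    by (simp add: sum_single_investor effort_single_investor effort_def[of _ _ x] x1[simplified])
  from exp_minus_plus_linear_ge(2)[OF N assms(2) this] show ?thesis .
qed

text \<open>User 1 solves the problem with \<open>K = 1\<close> and \<open>m = c / a\<close>,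
  leaving the risk \<open>c / a\<close>. The coalition's marginal benefit is then
  \<open>(N - 1) * c / a\<close>, less than its price \<open>c\<close> because
  \<open>N - 1 < a\<close>.\<close>

lemma exit_equilibrium_first_beta:
  assumes "2 \<le> N" "0 < c" "c < 1" "1 < a" and gt: "real N - 1 < a"
  shows "exit_equilibrium N (user_cost N a c) 1 (single_investor N 1 (ln (a / c) / a))"
    (is "exit_equilibrium _ _ _ ?x")
    and "0 < ln (a / c)"
proof -
  define m where "m = c / a"
  have m: "0 < m" and N: "0 \<le> real N - 1" using assms by (simp_all add: m_def)
  have Km: "a / c = 1 / m" by (simp add: m_def)
  show pos: "0 < ln (a / c)" using assms by simp
  have S: "(\<Sum>j=2..N. ?x j) = 0" by (simp add: sum_single_investor)
  have x1: "?x 1 = ln (a / c) / a" using assms by (simp add: single_investor_apply)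
  have eff: "effort N a ?x = ln (a / c)" using assms by (simp add: effort_single_investor)
  have "exp (- ln (a / c)) + c * (ln (a / c) / a) \<le> exp (- (a * t)) + c * t" for t
    using exp_minus_plus_linear_ge(1)[of 1 m "a * t"] exp_minus_plus_linear_at_min[of 1 m] m assms
    unfolding Km by (simp add: m_def)
  moreover have "(real N - 1) * exp (- ln (a / c))
        \<le> (real N - 1) * exp (- (ln (a / c) + (\<Sum>j=2..N. z j))) + c * (\<Sum>j=2..N. z j)"
    if "z \<in> profiles N" for z
  proof (rule exp_minus_plus_linear_mono[OF N])
    have "exp (- ln (a / c)) = c / a" using assms by (simp add: exp_minus)
    then show "(real N - 1) * exp (- ln (a / c)) \<le> c"
      using assms by (simp add: divide_le_eq mult.commute)
    show "0 \<le> (\<Sum>j=2..N. z j)"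
      using profiles_nonneg[OF that] by (intro sum_nonneg) auto
  qed
  moreover have "effort N a z = ln (a / c) + (\<Sum>j=2..N. z j)" if "z 1 = ln (a / c) / a" for z
    using that assms by (simp add: effort_def)
  moreover have "?x \<in> profiles N" using pos assms by (intro single_investor_mem_profiles) simp
  ultimately show "exit_equilibrium N (user_cost N a c) 1 ?x"
    using assms
    by (subst exit_equilibrium_iff)
      (auto simp: users_minus_first[simplified] effort_upd_first[simplified] eff S[simplified] x1[simplified])
qed

text \<open>All effort is user 1's, so comparing with the response \<open>ln (a / c) / a\<close>
  makes it the unique minimiser for \<open>K = 1\<close> and \<open>m = c / a\<close>.\<close>

lemma effort_exit_equilibrium_first_beta:
  assumes "2 \<le> N" "0 < c" "c < 1" "1 < a"
    and x: "exit_equilibrium N (user_cost N a c) 1 x"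
    and x0: "\<And>j. j \<in> {1..N} \<Longrightarrow> j \<noteq> 1 \<Longrightarrow> x j = 0"
  shows "effort N a x = ln (a / c)"
proof -
  define m where "m = c / a"
  have m: "0 < m" using assms by (simp_all add: m_def)
  have Km: "a / c = 1 / m" by (simp add: m_def)
  have S: "(\<Sum>j=2..N. x j) = 0" using x0 by auto
  have pos: "0 \<le> ln (a / c) / a" using assms by simp
  have "\<forall>y\<ge>0. exp (- effort N a x) + c * x 1 \<le> exp (- effort N a (x(1 := y))) + c * y"
    using x assms exit_equilibrium_iff[of 1 N a c x] by simp
  from this[rule_format, OF pos]
  have "1 * exp (- effort N a x) + m * effort N a x \<le> m + m * ln (1 / m)"
    using exp_minus_plus_linear_at_min[of 1 m] m assms
    unfolding effort_upd_first effort_def S Km by (simp add: m_def)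
  from exp_minus_plus_linear_ge(2)[OF _ m this] show ?thesis by (simp add: Km)
qed

section \<open>The Externality mechanism\<close>

text \<open>Only user 1 invests at the optimum, so the derivative in \<open>x 1\<close> is all that
  survives; it equals \<open>- a\<close> times the optimal risk \<open>c / (N * a)\<close>.\<close>

lemma externality_tax_other:
  assumes "2 \<le> N" "0 < c" "c < 1" "1 < a" and i: "i \<in> {2..N}"
  shows "externality_tax N (risk N a) (investment_cost c) i
    = c / (real N * a) * ln (real N * a / c)"
proof -
  define y where "y = ln (real N * a / c) / a"
  let ?x = "single_investor N 1 y"
  have x: "social_optimum N (user_cost N a c) = ?x"
    using social_optimum_eq[OF assms(1-4)] by (simp add: y_def)
  have xi: "?x i = 0" using i by (simp add: single_investor_apply)
  have x1: "?x 1 = y" using assms by (simp add: single_investor_apply)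
  have "((\<lambda>t. exp (- (a * t))) has_field_derivative (- a * exp (- (a * y)))) (at y)"
    by (auto intro!: derivative_eq_intros)
  then have "partial_deriv (risk N a i) 1 ?x = - a * exp (- (a * y))"
    unfolding partial_deriv_def risk_eq effort_upd_first x1
    using DERIV_imp_deriv by (simp add: sum_single_investor)
  also have "exp (- (a * y)) = c / (real N * a)"
    using assms by (simp add: y_def exp_minus)
  finally have d: "partial_deriv (risk N a i) 1 ?x = - a * (c / (real N * a))" .
  have "(\<Sum>j=1..N. ?x j * partial_deriv (risk N a i) j ?x) = ?x 1 * partial_deriv (risk N a i) 1 ?x"
    using assms by (subst sum_only_first[of _ N]) (auto simp: single_investor_apply)
  then show ?thesis
    using assms unfolding externality_tax_def x Let_def xi x1 d by (simp add: y_def mult.commute)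
qed

text \<open>User 2's condition amounts to \<open>(N - 1) * ln (N * a / c) \<le> 1\<close>. It fails
  as soon as \<open>N * a / c\<close> exceeds \<open>exp 1\<close>, which is automatic for
  \<open>N \<ge> 3\<close>; for \<open>N = 2\<close> this is exactly the assumption
  \<open>exp 1 * c < 2 * a\<close>.\<close>

lemma not_voluntary_participation:
  assumes "2 \<le> N" "0 < c" "c < 1" "1 < a"
    and x: "exit_equilibrium N (user_cost N a c) 2 (xh 2)"
    and x0: "\<And>j. j \<in> {1..N} \<Longrightarrow> j \<noteq> 1 \<Longrightarrow> xh 2 j = 0"
    and N3: "N \<ge> 3 \<or> exp 1 * c < 2 * a"
  shows "\<not> voluntary_participation N (user_cost N a c)
               (externality_tax N (risk N a) (investment_cost c)) xh"
proof
  assume "voluntary_participation N (user_cost N a c)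
               (externality_tax N (risk N a) (investment_cost c)) xh"
  then have le: "user_cost N a c 2 (social_optimum N (user_cost N a c))
      + externality_tax N (risk N a) (investment_cost c) 2 \<le> user_cost N a c 2 (xh 2)"
    using assms by (simp add: voluntary_participation_def)
  let ?L = "ln (real N * a / c)"
  have N: "0 < real N - 1" using assms by simp
  have "user_cost N a c 2 (xh 2) = c / ((real N - 1) * a)"
    using effort_exit_equilibrium_other[OF assms(1-4) _ x x0] assms N
    by (simp add: user_cost_eq x0 exp_minus)
  moreover have "user_cost N a c 2 (social_optimum N (user_cost N a c)) = c / (real N * a)"
    using assms unfolding social_optimum_eq[OF assms(1-4)] user_cost_eq
    by (simp add: single_investor_apply effort_single_investor exp_minus)
  moreover have "externality_tax N (risk N a) (investment_cost c) 2 = c / (real N * a) * ?L"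
    using assms by (intro externality_tax_other) auto
  ultimately have "c / (real N * a) * (1 + ?L) \<le> c / ((real N - 1) * a)"
    using le by (simp add: algebra_simps)
  then have "(c / a) * ((1 + ?L) / real N) \<le> (c / a) * (1 / (real N - 1))"
    by (simp add: mult.commute)
  then have "(1 + ?L) / real N \<le> 1 / (real N - 1)"
    using assms by (subst (asm) mult_le_cancel_left_pos) auto
  then have "(real N - 1) * ?L \<le> 1"
    using N by (simp add: field_simps)
  moreover have "1 < ?L \<and> 1 \<le> real N - 1"
  proof -
    have "exp 1 * c < real N * a"
    proof (cases "N \<ge> 3")
      case True
      have "exp 1 * c < 3 * 1"
        using exp_le assms by (intro mult_le_less_imp_less) auto
      also have "\<dots> \<le> real N * a" using True assms by (intro mult_mono) auto
      finally show ?thesis .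
    next
      case False
      then have "N = 2" using assms by simp
      then show ?thesis using N3 by simp
    qed
    then have "exp 1 < real N * a / c" using assms by (simp add: less_divide_eq)
    moreover have "0 < real N * a / c" using assms by simp
    ultimately have "ln (exp 1) < ?L" by (subst ln_less_cancel_iff) auto
    then show ?thesis using assms by simp
  qed
  moreover have "1 * ?L \<le> (real N - 1) * ?L"
    using calculation(2) by (intro mult_right_mono) auto
  ultimately show False by linarith
qed

section \<open>The Pivotal mechanism\<close>

text \<open>Passing from \<open>N - 1\<close> to \<open>N\<close> sharers raises the effort by
  \<open>ln (N / (N - 1))\<close>, paid by user 1 at price \<open>c / a\<close>, and lowers the
  coalition's total risk from \<open>c / a\<close> by \<open>c / (N * a)\<close>.\<close>

lemma pivotal_tax_other:
  assumes "2 \<le> N" "0 < c" "c < 1" "1 < a" and i: "i \<in> {2..N}"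
    and x: "exit_equilibrium N (user_cost N a c) i (xh i)"
    and x0: "\<And>j. j \<in> {1..N} \<Longrightarrow> j \<noteq> 1 \<Longrightarrow> xh i j = 0"
  shows "pivotal_tax N (user_cost N a c) xh i
    = c / a * (ln (real N / (real N - 1)) - 1 / real N)"
proof -
  have N: "0 < real N - 1" "0 < real N" using assms by simp_all
  have eff: "effort N a (xh i) = ln ((real N - 1) * a / c)"
    by (rule effort_exit_equilibrium_other[OF assms(1-5) x x0])
  have x1: "xh i 1 = ln ((real N - 1) * a / c) / a"
    using eff x0 assms by (simp add: effort_def field_simps)
  have "(\<Sum>j\<in>{1..N} - {i}. xh i j) = xh i 1"
    using i assms by (subst sum_only_first[of _ N]) (auto intro!: x0)
  then have 1: "(\<Sum>j\<in>{1..N} - {i}. user_cost N a c j (xh i))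
      = c / a + c * (ln ((real N - 1) * a / c) / a)"
    using assms N i by (subst sum_coalition_cost) (auto simp: eff exp_minus x1[simplified])
  have 2: "(\<Sum>j\<in>{1..N} - {i}. user_cost N a c j (social_optimum N (user_cost N a c)))
      = (real N - 1) * (c / (real N * a)) + c * (ln (real N * a / c) / a)"
    unfolding social_optimum_eq[OF assms(1-4)] using assms i
    by (subst sum_coalition_cost) (auto simp: sum_single_investor effort_single_investor exp_minus)
  have 3: "ln (real N * a / c) = ln (real N / (real N - 1)) + ln ((real N - 1) * a / c)"
    using N assms by (simp add: ln_div ln_mult)
  have 4: "(real N - 1) * (c / (real N * a)) = c / a - c / a * (1 / real N)"
    using N assms by (simp add: field_simps)
  show ?thesis
    unfolding pivotal_tax_def 1 2 3 4 by (simp add: algebra_simps add_divide_distrib)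
qed

text \<open>At the optimum the others bear only risk. Their exit cost is left in terms of the
  effort, as this is where cases \<alpha> and \<beta> differ.\<close>

lemma pivotal_tax_first:
  assumes "2 \<le> N" "0 < c" "c < 1" "1 < a"
  shows "pivotal_tax N (user_cost N a c) xh 1 = (real N - 1) * (c / (real N * a))
    - ((real N - 1) * exp (- effort N a (xh 1)) + c * (\<Sum>j=2..N. xh 1 j))"
proof -
  have "(\<Sum>j\<in>{1..N} - {1}. user_cost N a c j (social_optimum N (user_cost N a c)))
      = (real N - 1) * (c / (real N * a))"
    unfolding social_optimum_eq[OF assms(1-4)] using assms
    by (subst sum_coalition_cost) (auto simp: sum_single_investor effort_single_investor exp_minus)
  moreover have "(\<Sum>j\<in>{1..N} - {1}. user_cost N a c j (xh 1))
      = (real N - 1) * exp (- effort N a (xh 1)) + c * (\<Sum>j=2..N. xh 1 j)"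
    using assms by (subst sum_coalition_cost) (auto simp: users_minus_first[simplified])
  ultimately show ?thesis by (simp add: pivotal_tax_def)
qed

text \<open>The terms \<open>c / (N * a)\<close> of users 2 to \<open>N\<close> cancel the optimal
  risk in user 1's tax; what remains is bounded by
  \<open>(N - 1) * ln (N / (N - 1)) < 1\<close>.\<close>

lemma sum_pivotal_tax_less:
  assumes "2 \<le> N" "0 < c" "c < 1" "1 < a"
    and x: "\<And>i. i \<in> {2..N} \<Longrightarrow> exit_equilibrium N (user_cost N a c) i (xh i)"
    and x0: "\<And>i j. i \<in> {2..N} \<Longrightarrow> j \<in> {1..N} \<Longrightarrow> j \<noteq> 1 \<Longrightarrow> xh i j = 0"
  shows "(\<Sum>i=1..N. pivotal_tax N (user_cost N a c) xh i)
    < c / a - ((real N - 1) * exp (- effort N a (xh 1)) + c * (\<Sum>j=2..N. xh 1 j))"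
proof -
  have N: "0 < real N - 1" "0 < real N" using assms by simp_all
  have "(\<Sum>i=2..N. pivotal_tax N (user_cost N a c) xh i)
      = (\<Sum>i=2..N. c / a * (ln (real N / (real N - 1)) - 1 / real N))"
    by (intro sum.cong refl pivotal_tax_other[OF assms(1-4)] x x0)
  also have "\<dots> = c / a * ((real N - 1) * ln (real N / (real N - 1))) - (real N - 1) * (c / (real N * a))"
    using assms by (simp add: of_nat_diff algebra_simps diff_divide_distrib)
  finally have others: "(\<Sum>i=2..N. pivotal_tax N (user_cost N a c) xh i) = \<dots>" .
  \<comment> \<open>Strict because \<open>ln u = u - 1\<close> only at \<open>u = 1\<close>, while
    \<open>N / (N - 1) > 1\<close>.\<close>
  have "ln (real N / (real N - 1)) < real N / (real N - 1) - 1"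
    using N ln_le_minus_one[of "real N / (real N - 1)"] ln_eq_minus_one[of "real N / (real N - 1)"]
    by (force simp: field_simps)
  then have "(real N - 1) * ln (real N / (real N - 1)) < (real N - 1) * (real N / (real N - 1) - 1)"
    using N by (intro mult_strict_left_mono)
  also have "\<dots> = 1" using N by (simp add: field_simps)
  finally have "c / a * ((real N - 1) * ln (real N / (real N - 1))) < c / a * 1"
    using assms by (intro mult_strict_left_mono) auto
  then show ?thesis
    using sum_users_split[of N "pivotal_tax N (user_cost N a c) xh"] assms others
      pivotal_tax_first[OF assms(1-4), of xh] by simp
qed

section \<open>Cases \<alpha> and \<beta>\<close>

text \<open>The side condition in case \<beta> leaves out only \<open>N = 2\<close> with
  \<open>2 * a \<le> exp 1 * c\<close>. There the participation conditions of both users do hold,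
  for instance with \<open>a = 1.1\<close> and \<open>c = 0.9\<close>. In case \<alpha>,
  \<open>1 < a < N - 1\<close> already gives \<open>N \<ge> 3\<close>.\<close>

theorem mainTheorem3:
  fixes N :: nat and a c :: real
  assumes "2 \<le> N" and "0 < c" and "c < 1" and "1 < a"
  shows
    "(a < real N - 1 \<longrightarrow>
        (\<exists>xh. exit_equilibria N a c xh \<and> form_alpha N xh) \<and>
        (\<forall>xh. exit_equilibria N a c xh \<and> form_alpha N xh \<longrightarrow>
           \<not> voluntary_participation N (user_cost N a c)
               (externality_tax N (risk N a) (investment_cost c)) xh \<and>
           \<not> weak_budget_balance N (pivotal_tax N (user_cost N a c) xh))) \<and>
     (a > real N - 1 \<longrightarrow>
        (\<exists>xh. exit_equilibria N a c xh \<and> form_beta N xh) \<and>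
        (\<forall>xh. exit_equilibria N a c xh \<and> form_beta N xh \<longrightarrow>
           (N \<ge> 3 \<or> exp 1 * c < 2 * a \<longrightarrow>
             \<not> voluntary_participation N (user_cost N a c)
                 (externality_tax N (risk N a) (investment_cost c)) xh) \<and>
           \<not> weak_budget_balance N (pivotal_tax N (user_cost N a c) xh)))"
proof (intro conjI impI allI; (elim conjE)?)
  assume lt: "a < real N - 1"
  have N: "3 \<le> N" using lt assms by linarith
  show "\<exists>xh. exit_equilibria N a c xh \<and> form_alpha N xh"
  proof -
    let ?y = "ln ((real N - 1) / c)"
    define xh where "xh i = (if i = 1 then (\<lambda>j\<in>{1..N}. if j = 1 then 0 else ?y / (real N - 1))
      else single_investor N 1 (ln ((real N - 1) * a / c) / a))" for i :: nat
    have "exit_equilibrium N (user_cost N a c) i (xh i)" if "i \<in> {1..N}" for i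
      using that exit_equilibrium_first_alpha(1)[OF assms(2-4) lt]
        exit_equilibrium_other(1)[OF assms, of i] by (auto simp: xh_def)
    moreover have "form_alpha N xh"
      using exit_equilibrium_first_alpha(2)[OF assms(2-4) lt]
        exit_equilibrium_other(2)[OF assms, of 2] assms N
      by (auto simp: form_alpha_def xh_def single_investor_apply)
    ultimately show ?thesis unfolding exit_equilibria_def by blast
  qed
  fix xh assume eq: "exit_equilibria N a c xh" and form: "form_alpha N xh"
  have x: "exit_equilibrium N (user_cost N a c) i (xh i)" if "i \<in> {1..N}" for i
    using eq that by (simp add: exit_equilibria_def)
  have x0: "xh i j = 0" if "i \<in> {2..N}" "j \<in> {1..N}" "j \<noteq> 1" for i j
    using form that by (simp add: form_alpha_def)
  show "\<not> voluntary_participation N (user_cost N a c)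
               (externality_tax N (risk N a) (investment_cost c)) xh"
    using assms N by (intro not_voluntary_participation x x0) auto
  have x1: "xh 1 1 = 0" using form by (simp add: form_alpha_def)
  have eff: "effort N a (xh 1) = ln ((real N - 1) / c)"
    using assms N x1 by (intro effort_exit_equilibrium_first_alpha x) auto
  have S: "(\<Sum>j=2..N. xh 1 j) = effort N a (xh 1)" by (simp add: effort_def x1[simplified])
  have "(\<Sum>i=1..N. pivotal_tax N (user_cost N a c) xh i)
    < c / a - ((real N - 1) * exp (- effort N a (xh 1)) + c * (\<Sum>j=2..N. xh 1 j))"
    using assms x x0 by (intro sum_pivotal_tax_less) auto
  also have "\<dots> = c / a - (c + c * ln ((real N - 1) / c))"
    unfolding S eff using exp_minus_plus_linear_at_min[of "real N - 1" c] assms N by simp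
  also have "\<dots> \<le> 0"
  proof -
    have "c / a \<le> c" using assms by (simp add: divide_le_eq)
    moreover have "0 \<le> c * ln ((real N - 1) / c)" using assms N by simp
    ultimately show ?thesis by simp
  qed
  finally show "\<not> weak_budget_balance N (pivotal_tax N (user_cost N a c) xh)"
    by (simp add: weak_budget_balance_def)
next
  assume gt: "real N - 1 < a"
  show "\<exists>xh. exit_equilibria N a c xh \<and> form_beta N xh"
  proof -
    define xh where "xh i = single_investor N 1
      (if i = 1 then ln (a / c) / a else ln ((real N - 1) * a / c) / a)" for i :: nat
    have "exit_equilibrium N (user_cost N a c) i (xh i)" if "i \<in> {1..N}" for i
      using that exit_equilibrium_first_beta(1)[OF assms gt]
        exit_equilibrium_other(1)[OF assms, of i] by (auto simp: xh_def)
    moreover have "form_beta N xh"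
      using exit_equilibrium_first_beta(2)[OF assms gt]
        exit_equilibrium_other(2)[OF assms, of 2] assms
      by (auto simp: form_beta_def xh_def single_investor_apply)
    ultimately show ?thesis unfolding exit_equilibria_def by blast
  qed
  fix xh assume eq: "exit_equilibria N a c xh" and form: "form_beta N xh"
  have x: "exit_equilibrium N (user_cost N a c) i (xh i)" if "i \<in> {1..N}" for i
    using eq that by (simp add: exit_equilibria_def)
  have x0: "xh i j = 0" if "i \<in> {1..N}" "j \<in> {1..N}" "j \<noteq> 1" for i j
    using form that by (cases "i = 1") (simp_all add: form_beta_def)
  show "\<not> voluntary_participation N (user_cost N a c)
               (externality_tax N (risk N a) (investment_cost c)) xh"
    if "N \<ge> 3 \<or> exp 1 * c < 2 * a"
    using assms that by (intro not_voluntary_participation x x0) auto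
  have eff: "effort N a (xh 1) = ln (a / c)"
    using assms by (intro effort_exit_equilibrium_first_beta x x0) auto
  have S: "(\<Sum>j=2..N. xh 1 j) = 0" using assms by (intro sum.neutral ballI x0) auto
  have "(\<Sum>i=1..N. pivotal_tax N (user_cost N a c) xh i)
    < c / a - ((real N - 1) * exp (- effort N a (xh 1)) + c * (\<Sum>j=2..N. xh 1 j))"
    using assms x x0 by (intro sum_pivotal_tax_less) auto
  also have "\<dots> = c / a * 1 - c / a * (real N - 1)"
    unfolding S eff using assms by (simp add: exp_minus)
  \<comment> \<open>For \<open>N = 2\<close> this is an equality, and the deficit rests on the
    strictness of the preceding bound.\<close>
  also have "\<dots> \<le> 0"
    using assms mult_left_mono[of 1 "real N - 1" "c / a"] by simp
  finally show "\<not> weak_budget_balance N (pivotal_tax N (user_cost N a c) xh)"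
    by (simp add: weak_budget_balance_def)
qed

end
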